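(* Let $(a,c)\in\mathbb R\times\mathbb R$. The extended Lerch zeta function $\zeta_*(s,a,c)$ (defined in the context) is a meromorphic function of $s\in\mathbb C$ which has a simple pole at $s=1$ if $a\in\mathbb Z$ and is holomorphic on $\mathbb C$ otherwise. Moreover: (i) $\zeta_*(s,a+1,c)=\zeta_*(s,a,c)$; (ii) $\zeta_*(s,a,c+1)=e^{-2\pi i a}\zeta_*(s,a,c)$; (iii) for $k=0,1$ and $\pm=(-1)^k$, the completed extended functions $$\hat L_*^{\pm}(s,a,c):=\pi^{-\frac{s+k}{2}}\Gamma\Big(\frac{s+k}{2}\Big)\Big(\zeta_*(s,a,c)+(-1)^k e^{-2\pi i a}\zeta_*(s,1-a,1-c)\Big)$$ are meromorphic in $s\in\mathbb C$ and analytic except for possible simple poles at $s=0$ or $s=1$; poles occur only for $k=0$, and then if and only if $a\in\mathbb Z$ or $c\in\mathbb Z$. They satisfy, for $k=0,1$, $$\hat L_*^{\pm}(s,a,c)=i^k e^{-2\pi i ac}\,\hat L_*^{\pm}(1-s,1-c,a).$$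
   Context: Let $\delta_{\mathbb Z}(x)=1$ if $x\in\mathbb Z$ and $0$ otherwise. For real $a,c$ and $s\in\mathbb C\setminus\{0,1\}$ define $$\Lambda^{+}(s,a,c):=2\int_1^\infty\Big(\sum_{n\in\mathbb Z,\,n\ne -c}e^{2\pi i a n}e^{-\pi(n+c)^2x^2}\Big)x^{s-1}dx+2\int_1^\infty\Big(\sum_{n\in\mathbb Z,\,n\neq a}e^{2\pi i c(n-a)}e^{-\pi(n-a)^2y^2}\Big)y^{-s}dy+\frac{2\delta_{\mathbb Z}(a)}{s-1}-\frac{2\delta_{\mathbb Z}(c)e^{-2\pi i ac}}{s},$$ $$\Lambda^{-}(s,a,c):=2\int_1^\infty\Big(\sum_{n\in\mathbb Z}e^{2\pi i a n}(n+c)e^{-\pi(n+c)^2x^2}\Big)x^{s}dx-2i\int_1^\infty\Big(\sum_{n\in\mathbb Z}e^{2\pi i c(n-a)}(n-a)e^{-\pi(n-a)^2y^2}\Big)y^{1-s}dy,$$ and the extended Lerch zeta function $$\zeta_*(s,a,c):=\frac12\Big(\frac{\pi^{s/2}}{\Gamma(s/2)}\Lambda^{+}(s,a,c)+\frac{\pi^{(s+1)/2}}{\Gamma(\frac{s+1}{2})}\Lambda^{-}(s,a,c)\Big),$$ understood at removable points (such as $s=0$) by meromorphic continuation in $s$. For $0<a,c<1$ this coincides with the Lerch zeta function $\sum_{n\ge 0}e^{2\pi i n a}(n+c)^{-s}$ (analytically continued). *)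

theory Defs
  imports "HOL-Complex_Analysis.Complex_Analysis"
begin

definition delta_int :: "real \<Rightarrow> complex" where
  "delta_int x = (if x \<in> \<int> then 1 else 0)"

definition Lambda_plus :: "complex \<Rightarrow> real \<Rightarrow> real \<Rightarrow> complex" where
  "Lambda_plus s a c =
     2 * (LBINT x:{1..}.
            (\<Sum>\<^sub>\<infinity>n\<in>{n::int. of_int n \<noteq> - c}.
               exp (2 * of_real pi * \<i> * of_real a * of_int n)
               * exp (of_real (- pi * (of_int n + c)\<^sup>2 * x\<^sup>2)))
            * of_real x powr (s - 1))
   + 2 * (LBINT y:{1..}.
            (\<Sum>\<^sub>\<infinity>n\<in>{n::int. of_int n \<noteq> a}.
               exp (2 * of_real pi * \<i> * of_real c * of_real (of_int n - a))
               * exp (of_real (- pi * (of_int n - a)\<^sup>2 * y\<^sup>2)))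
            * of_real y powr (- s))
   + 2 * delta_int a / (s - 1)
   - 2 * delta_int c * exp (- 2 * of_real pi * \<i> * of_real a * of_real c) / s"

definition Lambda_minus :: "complex \<Rightarrow> real \<Rightarrow> real \<Rightarrow> complex" where
  "Lambda_minus s a c =
     2 * (LBINT x:{1..}.
            (\<Sum>\<^sub>\<infinity>n\<in>(UNIV :: int set).
               exp (2 * of_real pi * \<i> * of_real a * of_int n)
               * of_real (of_int n + c)
               * exp (of_real (- pi * (of_int n + c)\<^sup>2 * x\<^sup>2)))
            * of_real x powr s)
   - 2 * \<i> * (LBINT y:{1..}.
            (\<Sum>\<^sub>\<infinity>n\<in>(UNIV :: int set).
               exp (2 * of_real pi * \<i> * of_real c * of_real (of_int n - a))
               * of_real (of_int n - a)
               * exp (of_real (- pi * (of_int n - a)\<^sup>2 * y\<^sup>2)))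
            * of_real y powr (1 - s))"

text \<open>
  Values at removable points are the limits; at a pole \<^const>\<open>remove_sings\<close> returns \<open>0\<close>.
  At a pole of \<open>Gamma\<close> the library has \<open>Gamma z = 0\<close>, so the quotients below vanish there,
  in agreement with the entire function \<open>1 / Gamma\<close>. The one point where a removable
  singularity really has to be filled in is \<open>s = 0\<close>, for integral \<open>c\<close>.
\<close>
definition lerch_zeta_ext :: "complex \<Rightarrow> real \<Rightarrow> real \<Rightarrow> complex" where
  "lerch_zeta_ext s a c =
     remove_sings
       (\<lambda>z. 1 / 2 *
          (of_real pi powr (z / 2) / Gamma (z / 2) * Lambda_plus z a c
           + of_real pi powr ((z + 1) / 2) / Gamma ((z + 1) / 2) * Lambda_minus z a c))
       s"

text \<open>
  \<open>k = 0\<close> and \<open>k = 1\<close> give the functions with superscript plus and minus, respectively.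
  Here \<^const>\<open>remove_sings\<close> is needed at the poles of the Gamma factor, which are cancelled
  by zeros of the second factor (except at \<open>s = 0\<close> for \<open>k = 0\<close> and integral \<open>c\<close>), and at \<open>s = 1\<close> for \<open>k = 1\<close> and integral \<open>a\<close>.
\<close>
definition completed_lerch :: "nat \<Rightarrow> complex \<Rightarrow> real \<Rightarrow> real \<Rightarrow> complex" where
  "completed_lerch k s a c =
     remove_sings
       (\<lambda>z. of_real pi powr (- ((z + of_nat k) / 2)) * Gamma ((z + of_nat k) / 2)
          * (lerch_zeta_ext z a c
             + (- 1) ^ k * exp (- 2 * of_real pi * \<i> * of_real a)
               * lerch_zeta_ext z (1 - a) (1 - c)))
       s"

definition simple_pole :: "(complex \<Rightarrow> complex) \<Rightarrow> complex \<Rightarrow> bool" where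
  "simple_pole f z \<longleftrightarrow> is_pole f z \<and> zorder f z = - 1"

end

theory Submission
  imports Defs
begin

text \<open>
  Both \<open>\<Lambda>\<^sup>+\<close> and \<open>\<Lambda>\<^sup>-\<close> are the sum of an incomplete Mellin transform of a theta series with
  parameters \<open>(a, c)\<close>, of its dual with parameters \<open>(c, -a)\<close>, and of explicit polar terms. Over
  \<open>x \<ge> 1\<close> the theta series decay exponentially, so the integrals are entire in \<open>s\<close>, and
  the functional equation merely exchanges the two integrals: since the dual integral is part of the
  definition, Poisson summation is not needed. Translating and reflecting the summation index
  gives the quasi-periodicity and the parity of \<open>\<Lambda>\<^sup>\<plusminus>\<close>, and the parity shows that the completed
  functions are \<open>\<Lambda>\<^sup>\<plusminus>\<close> themselves. The only other ingredient is that the zero of \<open>1 / \<Gamma>(s / 2)\<close> at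
  \<open>s = 0\<close> cancels the pole of \<open>\<Lambda>\<^sup>+\<close> there.
\<close>

section \<open>Incomplete Mellin transforms of theta series\<close>

text \<open>Expanding \<open>x\<^sup>s = exp (s ln x)\<close> and integrating termwise yields an everywhere convergent power series in \<open>s\<close>.\<close>

lemma mellin_tail_entire:
  fixes g :: "real \<Rightarrow> complex"
  assumes meas: "set_borel_measurable lborel {1..} g"
  assumes int: "\<And>r. r \<ge> 0 \<Longrightarrow> set_integrable lborel {1..} (\<lambda>x. norm (g x) * x powr r)"
  shows "(\<lambda>s. LBINT x:{1..}. g x * of_real x powr s) holomorphic_on UNIV"
proof -
  define G where "G = (\<lambda>x. indicator {1..} x *\<^sub>R g x)"
  have G_meas [measurable]: "G \<in> borel_measurable lborel"
    using meas unfolding G_def set_borel_measurable_def .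
  have G_int: "integrable lborel (\<lambda>x. norm (G x) * x powr r)" if "r \<ge> 0" for r
  proof -
    have "(\<lambda>x. norm (G x) * x powr r) = (\<lambda>x. indicator {1..} x *\<^sub>R (norm (g x) * x powr r))"
      by (auto simp: G_def indicator_def)
    thus ?thesis using int[OF that] by (simp add: set_integrable_def)
  qed
  define f where "f = (\<lambda>s n x. G x * (s * of_real (ln x)) ^ n / fact n)"
  have f_meas: "f s n \<in> borel_measurable lborel" for s n
    unfolding f_def by measurable
  \<comment> \<open>On x >= 1 the logarithm is nonnegative, so the moduli of the terms form the
    exponential series of \<open>norm s * ln x\<close>. Its sum dominates every partial sum and is
    integrable by \<open>G_int\<close>, which justifies termwise integration.\<close>
  have norm_sums: "(\<lambda>n. norm (f s n x)) sums (norm (G x) * x powr norm s)" for s x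
  proof (cases "x \<ge> 1")
    case True
    have "(\<lambda>n. norm (G x) * ((norm s * ln x) ^ n /\<^sub>R fact n)) sums (norm (G x) * exp (norm s * ln x))"
      by (intro sums_mult exp_converges)
    moreover have "norm (f s n x) = norm (G x) * ((norm s * ln x) ^ n /\<^sub>R fact n)" for n
      using True by (simp add: f_def norm_mult norm_divide norm_power divide_simps)
    moreover have "x powr norm s = exp (norm s * ln x)"
      using True by (simp add: powr_def)
    ultimately show ?thesis by simp
  next
    case False
    thus ?thesis by (simp add: f_def G_def)
  qed
  have f_le: "norm (f s n x) \<le> norm (G x) * x powr norm s" for s n x
    using sum_le_suminf[OF sums_summable[OF norm_sums[of s x]], of "{n}"]
    by (simp add: sums_unique[OF norm_sums[of s x], symmetric])
  have f_int: "integrable lborel (f s n)" for s n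
    by (rule Bochner_Integration.integrable_bound[OF G_int[of "norm s"] f_meas])
       (use f_le[of s n] in \<open>auto intro: order_trans[OF _ abs_ge_self]\<close>)
  have f_sums: "(\<lambda>n. f s n x) sums (indicator {1..} x *\<^sub>R (g x * of_real x powr s))" for s x
  proof (cases "x \<ge> 1")
    case True
    have "(\<lambda>n. G x * ((s * of_real (ln x)) ^ n /\<^sub>R fact n)) sums (G x * exp (s * of_real (ln x)))"
      by (intro sums_mult exp_converges)
    moreover have "f s n x = G x * ((s * of_real (ln x)) ^ n /\<^sub>R fact n)" for n
      by (simp add: f_def scaleR_conv_of_real divide_simps)
    moreover have "of_real x powr s = exp (s * of_real (ln x))"
      using True by (simp add: powr_def Ln_of_real)
    ultimately show ?thesis using True by (simp add: G_def)
  next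
    case False
    thus ?thesis by (simp add: f_def G_def)
  qed
  have integral_sums: "(\<lambda>n. \<integral>x. f s n x \<partial>lborel) sums (LBINT x:{1..}. g x * of_real x powr s)" for s
  proof -
    have "(\<lambda>n. integral\<^sup>L lborel (f s n)) sums (\<integral>x. (\<Sum>n. f s n x) \<partial>lborel)"
    proof (rule sums_integral)
      show "AE x in lborel. summable (\<lambda>i. norm (f s i x))"
        using norm_sums by (auto intro: sums_summable)
      show "summable (\<lambda>i. \<integral>x. norm (f s i x) \<partial>lborel)"
      proof (rule bounded_imp_summable)
        fix n
        have "(\<Sum>i\<le>n. \<integral>x. norm (f s i x) \<partial>lborel) = (\<integral>x. (\<Sum>i\<le>n. norm (f s i x)) \<partial>lborel)"
          using f_int by simp
        also have "\<dots> \<le> (\<integral>x. norm (G x) * x powr norm s \<partial>lborel)"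
        proof (rule integral_mono)
          show "integrable lborel (\<lambda>x. \<Sum>i\<le>n. norm (f s i x))"
            using f_int by simp
          show "(\<Sum>i\<le>n. norm (f s i x)) \<le> norm (G x) * x powr norm s" for x
            using sum_le_suminf[OF sums_summable[OF norm_sums[of s x]], of "{..n}"]
            by (simp add: sums_unique[OF norm_sums[of s x], symmetric])
        qed (use G_int in auto)
        finally show "(\<Sum>i\<le>n. \<integral>x. norm (f s i x) \<partial>lborel)
            \<le> (\<integral>x. norm (G x) * x powr norm s \<partial>lborel)" .
      qed auto
    qed (rule f_int)
    thus ?thesis
      by (simp add: sums_unique[OF f_sums, symmetric] set_lebesgue_integral_def)
  qed
  \<comment> \<open>\<open>f s n\<close> is \<open>s ^ n\<close> times \<open>f 1 n\<close>, so the
    integrated series is a power series about 0 whose coefficients are free of s, convergent on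
    every ball.\<close>
  have hol: "(\<lambda>s. LBINT x:{1..}. g x * of_real x powr s) holomorphic_on ball 0 r" for r
  proof (rule power_series_holomorphic)
    fix s :: complex
    have "(\<integral>x. f s n x \<partial>lborel) = (\<integral>x. f 1 n x \<partial>lborel) * (s - 0) ^ n" for n
    proof -
      have "f s n = (\<lambda>x. f 1 n x * s ^ n)" by (auto simp: f_def power_mult_distrib)
      thus ?thesis by simp
    qed
    with integral_sums[of s]
    show "(\<lambda>n. (\<integral>x. f 1 n x \<partial>lborel) * (s - 0) ^ n) sums (LBINT x:{1..}. g x * of_real x powr s)"
      by simp
  qed
  show ?thesis
    unfolding holomorphic_on_def
  proof
    fix s :: complex
    have "(\<lambda>s. LBINT x:{1..}. g x * of_real x powr s) field_differentiable at s within ball 0 (norm s + 1)"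
      using hol[of "norm s + 1"] unfolding holomorphic_on_def by (auto simp: dist_norm)
    thus "(\<lambda>s. LBINT x:{1..}. g x * of_real x powr s) field_differentiable at s"
      by (subst (asm) at_within_open) auto
  qed
qed

section \<open>Convergence and exponential decay of the theta series\<close>

lemma int_exp_neg_abs_summable: "(\<lambda>n::int. exp (- \<bar>real_of_int n\<bar>)) summable_on UNIV"
proof -
  have geom: "summable (\<lambda>n. norm (exp (-1 :: real) ^ n))"
    by (simp add: summable_geometric)
  have exp_pow: "exp (- real n) = exp (-1) ^ n" for n
    by (simp flip: exp_of_nat_mult)
  have 1: "(\<lambda>n::int. exp (- \<bar>real_of_int n\<bar>)) summable_on (range int)"
    using norm_summable_imp_summable_on[OF geom]
    by (subst summable_on_reindex) (auto simp: o_def exp_pow)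
  have 2: "(\<lambda>n::int. exp (- \<bar>real_of_int n\<bar>)) summable_on (range (\<lambda>n. - int n))"
    using norm_summable_imp_summable_on[OF geom]
    by (subst summable_on_reindex) (auto simp: o_def exp_pow inj_def)
  have "(\<lambda>n::int. exp (- \<bar>real_of_int n\<bar>)) summable_on (range int \<union> (range (\<lambda>n. - int n) - range int))"
    by (intro summable_on_Un_disjoint 1 summable_on_subset[OF 2]) auto
  also have "range int \<union> (range (\<lambda>n. - int n) - range int) = UNIV"
    using int_cases2 by blast
  finally show ?thesis .
qed

text \<open>Only finitely many n satisfy |n + c| <= 1, so the least nonzero distance among them,
  capped at 1, serves. It supplies a decay rate that is uniform in n.\<close>

lemma integer_translate_bounded_away:
  fixes c :: real
  obtains d where "d > 0" "\<And>n::int. of_int n + c \<noteq> 0 \<Longrightarrow> d \<le> \<bar>of_int n + c\<bar>"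
proof -
  define S where "S = {n::int. of_int n + c \<noteq> 0 \<and> \<bar>of_int n + c\<bar> \<le> 1}"
  have "S \<subseteq> {\<lfloor>-c-1\<rfloor>..\<lceil>1-c\<rceil>}"
    unfolding S_def by (auto; linarith)
  hence fin: "finite S" by (rule finite_subset) auto
  define d where "d = Min (insert 1 ((\<lambda>n. \<bar>of_int n + c\<bar>) ` S))"
  have "d > 0"
    unfolding d_def using fin by (subst Min_gr_iff) (auto simp: S_def)
  moreover have "d \<le> \<bar>of_int n + c\<bar>" if "of_int n + c \<noteq> 0" for n :: int
  proof (cases "n \<in> S")
    case True
    thus ?thesis unfolding d_def using fin by (intro Min_le) auto
  next
    case False
    hence "1 \<le> \<bar>of_int n + c\<bar>" using that by (auto simp: S_def)
    moreover have "d \<le> 1" unfolding d_def using fin by (intro Min_le) auto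
    ultimately show ?thesis by linarith
  qed
  ultimately show ?thesis using that by blast
qed

definition theta_term :: "nat \<Rightarrow> real \<Rightarrow> real \<Rightarrow> real \<Rightarrow> int \<Rightarrow> complex" where
  "theta_term k a c x n =
     cis (2 * pi * (a * of_int n)) * of_real ((of_int n + c) ^ k)
     * exp (of_real (- pi * (of_int n + c)\<^sup>2 * x\<^sup>2))"

text \<open>Omitting n = -c removes, for k = 0, the constant term that would spoil decay in x. For k
  = 1 the omitted term is zero, so the same index set serves both cases.\<close>

definition theta_sum :: "nat \<Rightarrow> real \<Rightarrow> real \<Rightarrow> real \<Rightarrow> complex" where
  "theta_sum k a c x = (\<Sum>\<^sub>\<infinity>n\<in>{n::int. of_int n + c \<noteq> 0}. theta_term k a c x n)"

lemma norm_theta_term: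
  "norm (theta_term k a c x n) = \<bar>of_int n + c\<bar> ^ k * exp (- pi * (of_int n + c)\<^sup>2 * x\<^sup>2)"
  unfolding theta_term_def norm_mult exp_of_real norm_of_real by (simp add: power_abs)

text \<open>With u = |n + c|, the Gaussian exponent is at least 2 u^2 x^2 because pi >= 2. One half
  of this is at least d^2 x and gives the decay; the other is at least u^2 and pays both for u^k <=
  exp u and for the summable factor in n, since u - u^2 <= 1 - u and |n| <= u + |c|.\<close>

lemma norm_theta_term_le:
  assumes k: "k \<le> 1" and x: "x \<ge> 1" and d: "d > 0" "d \<le> \<bar>of_int n + c\<bar>"
  shows "norm (theta_term k a c x n) \<le> exp (- d\<^sup>2 * x) * (exp (1 + \<bar>c\<bar>) * exp (- \<bar>of_int n\<bar>))"
proof -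
  define u where "u = \<bar>of_int n + c\<bar>"
  have u: "d \<le> u" "u \<ge> 0" "u\<^sup>2 = (of_int n + c)\<^sup>2" using d by (auto simp: u_def)
  have "u ^ k \<le> exp u"
  proof (cases "k = 0")
    case False
    hence "k = 1" using k by auto
    thus ?thesis using exp_ge_add_one_self[of u] by (simp del: exp_ge_add_one_self)
  qed (use u in auto)
  have "d\<^sup>2 \<le> u\<^sup>2" using u d by (intro power_mono) auto
  moreover have "x \<le> x\<^sup>2" "1 \<le> x\<^sup>2" using x one_le_power[of x 2] by (auto simp: self_le_power)
  ultimately have "d\<^sup>2 * x \<le> u\<^sup>2 * x\<^sup>2" "u\<^sup>2 * 1 \<le> u\<^sup>2 * x\<^sup>2"
    using x by (auto intro: mult_mono mult_left_mono simp del: mult_1_right)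
  moreover have "2 * (u\<^sup>2 * x\<^sup>2) \<le> pi * (u\<^sup>2 * x\<^sup>2)"
    using pi_ge_two by (intro mult_right_mono) auto
  moreover have "(u - 1)\<^sup>2 \<ge> 0" by simp
  hence "u - u\<^sup>2 \<le> 1 - u" by (simp add: power2_eq_square algebra_simps)
  moreover have "\<bar>of_int n\<bar> \<le> u + \<bar>c\<bar>" by (simp add: u_def)
  ultimately have "u - pi * u\<^sup>2 * x\<^sup>2 \<le> - d\<^sup>2 * x + (1 + \<bar>c\<bar> - \<bar>of_int n\<bar>)"
    by (simp add: algebra_simps)
  hence "exp (u - pi * u\<^sup>2 * x\<^sup>2) \<le> exp (- d\<^sup>2 * x + (1 + \<bar>c\<bar> - \<bar>of_int n\<bar>))" by simp
  moreover have "norm (theta_term k a c x n) \<le> exp u * exp (- pi * u\<^sup>2 * x\<^sup>2)"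
    unfolding norm_theta_term u_def[symmetric] u(3)[symmetric]
    using \<open>u ^ k \<le> exp u\<close> by (intro mult_right_mono) auto
  moreover have "exp u * exp (- pi * u\<^sup>2 * x\<^sup>2) = exp (u - pi * u\<^sup>2 * x\<^sup>2)"
    by (simp add: mult_exp_exp)
  moreover have "exp (- d\<^sup>2 * x + (1 + \<bar>c\<bar> - \<bar>of_int n\<bar>))
      = exp (- d\<^sup>2 * x) * (exp (1 + \<bar>c\<bar>) * exp (- \<bar>of_int n\<bar>))"
    by (simp add: mult_exp_exp)
  ultimately show ?thesis by linarith
qed

lemma theta_term_abs_summable:
  assumes "k \<le> 1" "x \<ge> 1"
  shows "(\<lambda>n. norm (theta_term k a c x n)) summable_on {n. of_int n + c \<noteq> 0}"
proof -
  obtain d where d: "d > 0" "\<And>n::int. of_int n + c \<noteq> 0 \<Longrightarrow> d \<le> \<bar>of_int n + c\<bar>"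
    using integer_translate_bounded_away[of c] by metis
  show ?thesis
  proof (rule Infinite_Sum.abs_summable_on_comparison_test)
    show "(\<lambda>n::int. norm (exp (- d\<^sup>2 * x) * (exp (1 + \<bar>c\<bar>) * exp (- \<bar>of_int n\<bar>)))) summable_on {n. of_int n + c \<noteq> 0}"
      by (auto intro!: summable_on_cmult_right summable_on_subset[OF int_exp_neg_abs_summable])
  qed (use norm_theta_term_le[OF assms d(1)] d(2) in auto)
qed

lemma theta_sum_exp_decay:
  assumes "k \<le> 1"
  obtains C e where "C \<ge> 0" "e > 0" "\<And>x. x \<ge> 1 \<Longrightarrow> norm (theta_sum k a c x) \<le> C * exp (- e * x)"
proof -
  obtain d where d: "d > 0" "\<And>n::int. of_int n + c \<noteq> 0 \<Longrightarrow> d \<le> \<bar>of_int n + c\<bar>"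
    using integer_translate_bounded_away[of c] by metis
  let ?A = "{n::int. of_int n + c \<noteq> 0}"
  define C where "C = (\<Sum>\<^sub>\<infinity>n\<in>?A. exp (1 + \<bar>c\<bar>) * exp (- \<bar>of_int n\<bar>))"
  have "norm (theta_sum k a c x) \<le> C * exp (- d\<^sup>2 * x)" if x: "x \<ge> 1" for x
  proof -
    have "norm (theta_sum k a c x) \<le> (\<Sum>\<^sub>\<infinity>n\<in>?A. norm (theta_term k a c x n))"
      unfolding theta_sum_def by (rule norm_infsum_bound[OF theta_term_abs_summable[OF assms x]])
    also have "\<dots> \<le> (\<Sum>\<^sub>\<infinity>n\<in>?A. exp (- d\<^sup>2 * x) * (exp (1 + \<bar>c\<bar>) * exp (- \<bar>of_int n\<bar>)))"
      using norm_theta_term_le[OF assms x d(1)] d(2) theta_term_abs_summable[OF assms x]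
      by (intro infsum_mono)
         (auto intro!: summable_on_cmult_right summable_on_subset[OF int_exp_neg_abs_summable])
    also have "\<dots> = C * exp (- d\<^sup>2 * x)"
      unfolding C_def by (subst infsum_cmult_right') simp
    finally show ?thesis .
  qed
  moreover have "C \<ge> 0" unfolding C_def by (intro infsum_nonneg) auto
  ultimately show ?thesis using that[of C "d\<^sup>2"] d(1) by auto
qed

lemma theta_sum_measurable:
  assumes "k \<le> 1"
  shows "set_borel_measurable lborel {1..} (theta_sum k a c)"
proof -
  let ?A = "{n::int. of_int n + c \<noteq> 0}"
  \<comment> \<open>An infinite sum is a limit along the net of finite subsets, whereas
    measurability passes only to sequential limits. The intersections of symmetric intervals with
    the index set form a cofinal sequence of finite sets.\<close>
  define F where "F = (\<lambda>N::nat. {- int N..int N} \<inter> ?A)"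
  have F: "filterlim F (finite_subsets_at_top ?A) sequentially"
    unfolding filterlim_finite_subsets_at_top
  proof safe
    fix X :: "int set" assume X: "finite X" "X \<subseteq> ?A"
    have "finite ((\<lambda>n. nat \<bar>n\<bar>) ` X)" using X by auto
    then obtain M where M: "\<And>n. n \<in> X \<Longrightarrow> nat \<bar>n\<bar> \<le> M"
      by (meson finite_nat_set_iff_bounded_le imageI)
    have "X \<subseteq> F N" if "N \<ge> M" for N
      using X M that unfolding F_def by fastforce
    thus "eventually (\<lambda>N. finite (F N) \<and> X \<subseteq> F N \<and> F N \<subseteq> ?A) sequentially"
      unfolding eventually_sequentially by (intro exI[of _ M]) (auto simp: F_def)
  qed
  show ?thesis
    unfolding set_borel_measurable_def
  proof (rule borel_measurable_LIMSEQ_metric)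
    fix N
    show "(\<lambda>x. indicator {1..} x *\<^sub>R (\<Sum>n\<in>F N. theta_term k a c x n)) \<in> borel_measurable lborel"
      unfolding theta_term_def by measurable
  next
    fix x :: real
    show "(\<lambda>N. indicator {1..} x *\<^sub>R (\<Sum>n\<in>F N. theta_term k a c x n))
            \<longlonglongrightarrow> indicator {1..} x *\<^sub>R theta_sum k a c x"
    proof (cases "x \<ge> 1")
      case True
      have "(theta_term k a c x has_sum theta_sum k a c x) ?A"
        unfolding theta_sum_def
        by (rule has_sum_infsum[OF abs_summable_summable[OF theta_term_abs_summable[OF assms True]]])
      hence "(\<lambda>N. \<Sum>n\<in>F N. theta_term k a c x n) \<longlonglongrightarrow> theta_sum k a c x"
        unfolding has_sum_def by (rule filterlim_compose[OF _ F])
      thus ?thesis by (intro tendsto_intros)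
    qed auto
  qed
qed

text \<open>Up to taking moduli this is Euler's integral for Gamma at r + 1, restricted from the
  positive axis to [1, oo) and then moved from the completed measure to
  \<open>lborel\<close>.\<close>

lemma exp_decay_powr_integrable:
  fixes r e :: real
  assumes "r \<ge> 0" "e > 0"
  shows "set_integrable lborel {1..} (\<lambda>x. exp (- e * x) * x powr r)"
proof -
  have "(\<lambda>t. complex_of_real t powr (of_real (r + 1) - 1) / of_real (exp (e * t)))
           absolutely_integrable_on {0<..}"
    using assms by (intro absolutely_integrable_Gamma_integral) auto
  hence "set_integrable lebesgue {1..} (\<lambda>t. complex_of_real t powr (of_real (r + 1) - 1) / of_real (exp (e * t)))"
    by (rule set_integrable_subset) auto
  hence "set_integrable lebesgue {1..} (\<lambda>t. norm (complex_of_real t powr (of_real (r + 1) - 1) / of_real (exp (e * t))))"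
    by (rule set_integrable_norm)
  also have "?this \<longleftrightarrow> set_integrable lebesgue {1..} (\<lambda>x. exp (- e * x) * x powr r)"
    by (intro set_integrable_cong refl)
       (auto simp: norm_divide norm_powr_real_powr exp_minus field_simps)
  finally have "integrable lebesgue (\<lambda>x. indicator {1..} x *\<^sub>R (exp (- e * x) * x powr r))"
    by (simp add: set_integrable_def)
  thus ?thesis
    unfolding set_integrable_def by (subst (asm) integrable_completion) (auto)
qed

definition theta_mellin :: "nat \<Rightarrow> real \<Rightarrow> real \<Rightarrow> complex \<Rightarrow> complex" where
  "theta_mellin k a c s = (LBINT x:{1..}. theta_sum k a c x * of_real x powr s)"

lemma theta_mellin_entire:
  assumes "k \<le> 1"
  shows "theta_mellin k a c holomorphic_on UNIV"
proof -
  have "(\<lambda>s. LBINT x:{1..}. theta_sum k a c x * of_real x powr s) holomorphic_on UNIV"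
  proof (rule mellin_tail_entire)
    show meas: "set_borel_measurable lborel {1..} (theta_sum k a c)"
      by (rule theta_sum_measurable) fact
    fix r :: real assume r: "r \<ge> 0"
    obtain C e where C: "C \<ge> 0" "e > 0"
      "\<And>x. x \<ge> 1 \<Longrightarrow> norm (theta_sum k a c x) \<le> C * exp (- e * x)"
      using theta_sum_exp_decay[OF assms, of a c] by metis
    have "set_integrable lborel {1..} (\<lambda>x. C * (exp (- e * x) * x powr r))"
      using exp_decay_powr_integrable[OF r C(2)] by simp
    thus "set_integrable lborel {1..} (\<lambda>x. norm (theta_sum k a c x) * x powr r)"
    proof (rule set_integrable_bound)
      have "(\<lambda>x. norm (indicator {1..} x *\<^sub>R theta_sum k a c x) * x powr r) \<in> borel_measurable lborel"
        using meas unfolding set_borel_measurable_def by measurable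
      also have "(\<lambda>x. norm (indicator {1..} x *\<^sub>R theta_sum k a c x) * x powr r)
          = (\<lambda>x. indicator {1..} x *\<^sub>R (norm (theta_sum k a c x) * x powr r))"
        by (auto simp: indicator_def)
      finally show "set_borel_measurable lborel {1..} (\<lambda>x. norm (theta_sum k a c x) * x powr r)"
        unfolding set_borel_measurable_def .
    qed (use C in \<open>auto simp: abs_mult mult.assoc[symmetric] intro!: mult_right_mono\<close>)
  qed
  thus ?thesis by (simp add: theta_mellin_def[abs_def])
qed

section \<open>Quasi-periodicity and parity of the theta series\<close>

lemma theta_sum_shift_left: "theta_sum k (a + 1) c x = theta_sum k a c x"
proof -
  have "cis (2 * pi * ((a + 1) * of_int n)) = cis (2 * pi * (a * of_int n))" for n
    using cis_multiple_2pi[of "of_int n"] by (simp add: distrib_right distrib_left flip: cis_mult)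
  thus ?thesis by (simp add: theta_sum_def theta_term_def)
qed

text \<open>Reindexing by m = n + 1 absorbs the shift of c, and the character exp(2 pi i a n) leaves
  a constant phase behind.\<close>

lemma theta_sum_shift_right: "theta_sum k a (c + 1) x = cis (- (2 * pi * a)) * theta_sum k a c x"
proof -
  have "theta_sum k a (c + 1) x
      = (\<Sum>\<^sub>\<infinity>n\<in>{n::int. of_int n + c \<noteq> 0}. cis (- (2 * pi * a)) * theta_term k a c x n)"
    unfolding theta_sum_def
  proof (rule infsum_reindex_bij_witness[of _ "\<lambda>n. n - 1" "\<lambda>n. n + 1"])
    fix n :: int
    show "cis (- (2 * pi * a)) * theta_term k a c x (n + 1) = theta_term k a (c + 1) x n"
    proof -
      have "cis (- (2 * pi * a)) * cis (2 * pi * (a * of_int (n + 1))) = cis (2 * pi * (a * of_int n))"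
        by (simp add: cis_mult algebra_simps)
      thus ?thesis
        by (simp add: theta_term_def add_ac flip: mult.assoc)
    qed
  qed (auto simp: algebra_simps)
  thus ?thesis by (simp add: theta_sum_def infsum_cmult_right')
qed

lemma theta_sum_reflect: "theta_sum k (-a) (-c) x = (-1) ^ k * theta_sum k a c x"
proof -
  have "theta_sum k (-a) (-c) x
      = (\<Sum>\<^sub>\<infinity>n\<in>{n::int. of_int n + c \<noteq> 0}. (-1) ^ k * theta_term k a c x n)"
    unfolding theta_sum_def
  proof (rule infsum_reindex_bij_witness[of _ uminus uminus])
    fix n :: int
    have "of_int n - c = - (of_int (- n) + c)" by simp
    hence "(of_int n - c) ^ k = (-1) ^ k * (of_int (- n) + c) ^ k"
      by (metis power_minus)
    moreover have "(of_int n - c)\<^sup>2 = (of_int (- n) + c)\<^sup>2"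
      by (simp add: power2_eq_square algebra_simps)
    ultimately show "(-1) ^ k * theta_term k a c x (- n) = theta_term k (-a) (-c) x n"
      by (simp add: theta_term_def)
  qed auto
  thus ?thesis by (simp add: theta_sum_def infsum_cmult_right')
qed

lemma theta_mellin_shift_left: "theta_mellin k (a + 1) c s = theta_mellin k a c s"
  by (simp add: theta_mellin_def theta_sum_shift_left)

lemma theta_mellin_shift_right:
  "theta_mellin k a (c + 1) s = cis (- (2 * pi * a)) * theta_mellin k a c s"
  by (simp add: theta_mellin_def theta_sum_shift_right mult.assoc)

lemma theta_mellin_reflect: "theta_mellin k (-a) (-c) s = (-1) ^ k * theta_mellin k a c s"
  by (simp add: theta_mellin_def theta_sum_reflect mult.assoc)

section \<open>The functions \<open>\<Lambda>\<^sup>\<plusminus>\<close>\<close>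

text \<open>The index k merges the two cases: the exponents become s - 1 and -s for k = 0, s and 1 -
  s for k = 1, and the constants 2 and -2i are 2 (-i)^k. The phase is the constant part of exp(2 pi
  i c (n - a)) in the dual series.\<close>

definition Lambda_entire :: "nat \<Rightarrow> complex \<Rightarrow> real \<Rightarrow> real \<Rightarrow> complex" where
  "Lambda_entire k s a c = 2 * theta_mellin k a c (s + of_nat k - 1)
     + 2 * (- \<i>) ^ k * cis (- (2 * pi * (a * c))) * theta_mellin k c (-a) (of_nat k - s)"

definition Lambda :: "nat \<Rightarrow> complex \<Rightarrow> real \<Rightarrow> real \<Rightarrow> complex" where
  "Lambda k s a c = Lambda_entire k s a c
     + (if k = 0 then 2 * delta_int a / (s - 1) - 2 * delta_int c * cis (- (2 * pi * (a * c))) / s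
        else 0)"

text \<open>The weight f and the index set A are left open so as to cover both written forms: weight
  1 on the punctured integers for k = 0, and weight n - a on all integers for k = 1, where the extra
  term vanishes. The same holds for \<open>theta_sum_direct\<close>.\<close>

lemma theta_sum_dual:
  assumes "\<And>n. of_int n \<noteq> a \<Longrightarrow> f n = of_real ((of_int n - a) ^ k)"
    and "\<And>n. of_int n = a \<Longrightarrow> n \<in> A \<Longrightarrow> f n = 0" "{n. of_int n \<noteq> a} \<subseteq> A"
  shows "(\<Sum>\<^sub>\<infinity>n\<in>A. exp (2 * of_real pi * \<i> * of_real c * of_real (of_int n - a)) * f n
            * exp (of_real (- pi * (of_int n - a)\<^sup>2 * y\<^sup>2)))
       = cis (- (2 * pi * (a * c))) * theta_sum k c (-a) y"
proof -
  have "exp (2 * of_real pi * \<i> * of_real c * of_real (of_int n - a))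
      = cis (- (2 * pi * (a * c))) * cis (2 * pi * (c * of_int n))" for n
    by (simp add: cis_conv_exp exp_add[symmetric] algebra_simps)
  hence "(\<Sum>\<^sub>\<infinity>n\<in>A. exp (2 * of_real pi * \<i> * of_real c * of_real (of_int n - a)) * f n
            * exp (of_real (- pi * (of_int n - a)\<^sup>2 * y\<^sup>2)))
      = (\<Sum>\<^sub>\<infinity>n\<in>{n. of_int n + - a \<noteq> 0}. cis (- (2 * pi * (a * c))) * theta_term k c (-a) y n)"
    using assms by (intro infsum_cong_neutral) (auto simp: theta_term_def)
  thus ?thesis by (simp add: theta_sum_def infsum_cmult_right')
qed

lemma theta_sum_direct:
  assumes "\<And>n. of_int n \<noteq> -c \<Longrightarrow> f n = of_real ((of_int n + c) ^ k)"
    and "\<And>n. of_int n = -c \<Longrightarrow> n \<in> A \<Longrightarrow> f n = 0" "{n. of_int n \<noteq> -c} \<subseteq> A"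
  shows "(\<Sum>\<^sub>\<infinity>n\<in>A. exp (2 * of_real pi * \<i> * of_real a * of_int n) * f n
            * exp (of_real (- pi * (of_int n + c)\<^sup>2 * x\<^sup>2)))
       = theta_sum k a c x"
proof -
  have "exp (2 * of_real pi * \<i> * of_real a * of_int n) = cis (2 * pi * (a * of_int n))" for n
    by (simp add: cis_conv_exp algebra_simps)
  thus ?thesis
    unfolding theta_sum_def using assms
    by (intro infsum_cong_neutral) (auto simp: theta_term_def eq_neg_iff_add_eq_0)
qed

lemma Lambda_plus_eq: "Lambda_plus s a c = Lambda 0 s a c"
proof -
  have "(\<Sum>\<^sub>\<infinity>n\<in>{n::int. of_int n \<noteq> - c}. exp (2 * of_real pi * \<i> * of_real a * of_int n)
             * exp (of_real (- pi * (of_int n + c)\<^sup>2 * x\<^sup>2))) = theta_sum 0 a c x" for x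
    using theta_sum_direct[of c "\<lambda>_. 1" 0 "{n. of_int n \<noteq> - c}" a x] by simp
  moreover have "(\<Sum>\<^sub>\<infinity>n\<in>{n::int. of_int n \<noteq> a}.
               exp (2 * of_real pi * \<i> * of_real c * of_real (of_int n - a))
               * exp (of_real (- pi * (of_int n - a)\<^sup>2 * y\<^sup>2)))
        = cis (- (2 * pi * (a * c))) * theta_sum 0 c (-a) y" for y
    using theta_sum_dual[of a "\<lambda>_. 1" 0 "{n. of_int n \<noteq> a}" c y] by simp
  moreover have "exp (- 2 * of_real pi * \<i> * of_real a * of_real c) = cis (- (2 * pi * (a * c)))"
    by (simp add: cis_conv_exp algebra_simps)
  ultimately show ?thesis
    unfolding Lambda_plus_def Lambda_def Lambda_entire_def
    by (simp add: theta_mellin_def mult.assoc)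
qed

lemma Lambda_minus_eq: "Lambda_minus s a c = Lambda 1 s a c"
proof -
  have "(\<Sum>\<^sub>\<infinity>n\<in>(UNIV :: int set). exp (2 * of_real pi * \<i> * of_real a * of_int n)
             * of_real (of_int n + c)
             * exp (of_real (- pi * (of_int n + c)\<^sup>2 * x\<^sup>2))) = theta_sum 1 a c x" for x
    by (rule theta_sum_direct) auto
  moreover have "(\<Sum>\<^sub>\<infinity>n\<in>(UNIV :: int set).
               exp (2 * of_real pi * \<i> * of_real c * of_real (of_int n - a))
               * of_real (of_int n - a)
               * exp (of_real (- pi * (of_int n - a)\<^sup>2 * y\<^sup>2)))
        = cis (- (2 * pi * (a * c))) * theta_sum 1 c (-a) y" for y
    by (rule theta_sum_dual) auto
  ultimately show ?thesis
    unfolding Lambda_minus_def Lambda_def Lambda_entire_def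
    by (simp add: theta_mellin_def mult.assoc)
qed

section \<open>Symmetries and functional equation of Lambda\<close>

lemma delta_int_add_one: "delta_int (x + 1) = delta_int x"
  using Ints_add[of x 1] Ints_diff[of "x + 1" 1] by (auto simp: delta_int_def)

lemma delta_int_uminus: "delta_int (- x) = delta_int x"
  by (simp add: delta_int_def)

text \<open>Where the indicator is nonzero, the phase is 1. This lets the polar terms take part in
  the same transformation laws as the integrals.\<close>

lemma delta_int_cis: "delta_int x * cis (- (2 * pi * x)) = delta_int x"
  using cis_multiple_2pi[of "-x"] by (auto simp: delta_int_def)

text \<open>The prefactor of the dual integral gains exp(-2 pi i c), while the dual theta series,
  its second parameter lowered from -a to -a - 1, gains the inverse phase.\<close>

lemma Lambda_shift_left: "Lambda k s (a + 1) c = Lambda k s a c"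
proof -
  have 1: "cis (- (2 * pi * ((a + 1) * c))) = cis (- (2 * pi * (a * c))) * cis (- (2 * pi * c))"
    by (simp add: cis_mult algebra_simps)
  have 2: "theta_mellin k c (- (a + 1)) s = cis (2 * pi * c) * theta_mellin k c (- a) s" for s
    using theta_mellin_shift_right[of k c "- (a + 1)" s] by (simp add: cis_mult flip: mult.assoc)
  have E: "Lambda_entire k s (a + 1) c = Lambda_entire k s a c"
    unfolding Lambda_entire_def 1 2 theta_mellin_shift_left
    using cis_mult[of "- (2 * pi * c)" "2 * pi * c"] by (simp add: mult.left_commute[of "cis (2 * pi * c)"])
  have P: "2 * delta_int c * cis (- (2 * pi * ((a + 1) * c))) = 2 * delta_int c * cis (- (2 * pi * (a * c)))"
    unfolding 1 using delta_int_cis[of c] by (simp add: mult_ac)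
  show ?thesis
    unfolding Lambda_def E P delta_int_add_one ..
qed

lemma Lambda_shift_right: "Lambda k s a (c + 1) = cis (- (2 * pi * a)) * Lambda k s a c"
proof -
  have 1: "cis (- (2 * pi * (a * (c + 1)))) = cis (- (2 * pi * a)) * cis (- (2 * pi * (a * c)))"
    by (simp add: cis_mult algebra_simps)
  have E: "Lambda_entire k s a (c + 1) = cis (- (2 * pi * a)) * Lambda_entire k s a c"
    unfolding Lambda_entire_def 1 theta_mellin_shift_right theta_mellin_shift_left
    by (simp only: ring_distribs mult_ac)
  \<comment> \<open>The pole at s = 1 carries no phase of its own; one is inserted so that it can be
    factored out of every summand.\<close>
  have P: "2 * delta_int a / (s - 1) = cis (- (2 * pi * a)) * (2 * delta_int a / (s - 1))"
    using delta_int_cis[of a] by (simp add: mult_ac)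
  show ?thesis
    unfolding Lambda_def E 1 delta_int_add_one
    by (subst P) (simp add: ring_distribs mult_ac)
qed

lemma theta_mellin_reflect': "theta_mellin k (-c) a s = (-1) ^ k * theta_mellin k c (-a) s"
  using theta_mellin_reflect[of k c "-a" s] by simp

lemma Lambda_reflect: "Lambda k s (-a) (-c) = (-1) ^ k * Lambda k s a c"
  unfolding Lambda_def Lambda_entire_def
  by (simp add: theta_mellin_reflect theta_mellin_reflect'[of k c a] delta_int_uminus ring_distribs mult_ac)

text \<open>Reflect, then shift both parameters by one. Only the second shift costs a phase, and it
  is taken at -a.\<close>

lemma Lambda_one_minus: "Lambda k s (1 - a) (1 - c) = (-1) ^ k * cis (2 * pi * a) * Lambda k s a c"
proof -
  have "Lambda k s (1 - a) (1 - c) = Lambda k s (-a + 1) (-c + 1)" by (simp add: algebra_simps)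
  also have "\<dots> = Lambda k s (-a) (-c + 1)"
    by (rule Lambda_shift_left)
  also have "\<dots> = cis (2 * pi * a) * Lambda k s (-a) (-c)"
    unfolding Lambda_shift_right by simp
  finally show ?thesis by (simp add: Lambda_reflect mult_ac)
qed

text \<open>Replacing s by 1 - s exchanges the exponents s + k - 1 and k - s, and the parameter
  change exchanges the two theta series up to the parity sign. The constants match because i^k
  (-i)^k = 1 and i^k (-1)^k = (-i)^k. The two polar terms also trade places.\<close>

lemma Lambda_functional_equation:
  "Lambda k s a c = \<i> ^ k * cis (- (2 * pi * (a * c))) * Lambda k (1 - s) (1 - c) a"
proof -
  have 1: "Lambda k (1 - s) (1 - c) a = Lambda k (1 - s) (-c) a"
    using Lambda_shift_left[of k "1 - s" "-c" a] by (simp add: algebra_simps)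
  have 3: "\<i> ^ k * (- \<i>) ^ k = 1" "\<i> ^ k * (-1) ^ k = (- \<i>) ^ k"
    by (simp_all flip: power_mult_distrib)
  have 4: "cis (- (2 * pi * (a * c))) * cis (2 * pi * (a * c)) = 1"
    by (simp add: cis_mult)
  have "Lambda_entire k (1 - s) (-c) a = 2 * (-1) ^ k * theta_mellin k c (-a) (of_nat k - s)
        + 2 * (- \<i>) ^ k * cis (2 * pi * (a * c)) * theta_mellin k a c (s + of_nat k - 1)"
    unfolding Lambda_entire_def theta_mellin_reflect'[of k c a] by (simp add: algebra_simps)
  hence "\<i> ^ k * cis (- (2 * pi * (a * c))) * Lambda_entire k (1 - s) (-c) a
     = 2 * (\<i> ^ k * (-1) ^ k) * cis (- (2 * pi * (a * c))) * theta_mellin k c (-a) (of_nat k - s)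
     + 2 * (\<i> ^ k * (- \<i>) ^ k) * (cis (- (2 * pi * (a * c))) * cis (2 * pi * (a * c)))
         * theta_mellin k a c (s + of_nat k - 1)"
    by (simp only: ring_distribs mult_ac)
  also have "\<dots> = Lambda_entire k s a c"
    unfolding 3 4 Lambda_entire_def by simp
  finally have E: "\<i> ^ k * cis (- (2 * pi * (a * c))) * Lambda_entire k (1 - s) (-c) a
     = Lambda_entire k s a c" .
  \<comment> \<open>Since division by zero yields 0, this holds at s = 1 too, so the functional
    equation is an identity for all s without exceptional points.\<close>
  have "1 / (1 - s) = - (1 / (s - 1))"
    by (metis minus_diff_eq minus_divide_right)
  hence P: "cis (- (2 * pi * (a * c))) * (2 * delta_int c / (1 - s - 1)
       - 2 * delta_int a * cis (2 * pi * (a * c)) / (1 - s))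
     = (cis (- (2 * pi * (a * c))) * cis (2 * pi * (a * c))) * (2 * delta_int a / (s - 1)) 
        - 2 * delta_int c * cis (- (2 * pi * (a * c))) / s"
    by (simp add: divide_inverse algebra_simps)
  show ?thesis
  proof (cases "k = 0")
    case True
    have "cis (- (2 * pi * (a * c))) * Lambda 0 (1 - s) (-c) a
        = cis (- (2 * pi * (a * c))) * Lambda_entire 0 (1 - s) (-c) a
          + cis (- (2 * pi * (a * c))) * (2 * delta_int c / (1 - s - 1)
              - 2 * delta_int a * cis (2 * pi * (a * c)) / (1 - s))"
      by (simp add: Lambda_def delta_int_uminus distrib_left mult.commute[of c a])
    also have "\<dots> = Lambda 0 s a c"
      using E unfolding P 4 by (simp add: True Lambda_def)
    finally show ?thesis unfolding 1 by (simp add: True)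
  next
    case False
    thus ?thesis unfolding 1 using E by (simp add: Lambda_def)
  qed
qed

lemma Lambda_entire_holomorphic:
  assumes "k \<le> 1"
  shows "(\<lambda>s. Lambda_entire k s a c) holomorphic_on A"
proof -
  have "(\<lambda>s. theta_mellin k a c (f s)) holomorphic_on A" if "f holomorphic_on A" for f a c
    using holomorphic_on_compose_gen[OF that theta_mellin_entire[OF assms, of a c]]
    by (simp add: o_def)
  note [holomorphic_intros] = this
  show ?thesis unfolding Lambda_entire_def by (intro holomorphic_intros)
qed

section \<open>Simple poles and removable singularities\<close>

lemma simple_poleI:
  assumes "open S" "p \<in> S" "g holomorphic_on S" "g p \<noteq> 0"
    and f: "\<And>w. w \<in> S \<Longrightarrow> w \<noteq> p \<Longrightarrow> f w = g w / (w - p)"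
  shows "simple_pole f p"
proof -
  have "eventually (\<lambda>w. w \<in> S - {p}) (at p)"
    using assms by (intro eventually_at_in_open) auto
  hence "eventually (\<lambda>w. f w = g w / (w - p) ^ 1) (at p)"
    by eventually_elim (use f in auto)
  hence "is_pole f p"
    using is_pole_basic[of g S p 1] assms is_pole_cong[of f "\<lambda>w. g w / (w - p) ^ 1" p p] by auto
  moreover have "zorder f p = -1"
    by (rule zorder_eqI[of S p g]) (use assms in \<open>auto simp: f power_int_minus divide_inverse\<close>)
  ultimately show ?thesis by (simp add: simple_pole_def)
qed

lemma simple_pole_remove_sings:
  assumes "f meromorphic_on {p}" "simple_pole f p"
  shows "simple_pole (remove_sings f) p"
  using assms meromorphic_on_isolated_singularity[OF assms(1)] by (simp add: simple_pole_def)

text \<open>A nonzero factor can be divided back out, so both functions have a limit or neither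
  does; in the latter case both sides are the default value 0.\<close>

lemma remove_sings_cmult:
  assumes "k \<noteq> 0"
  shows "remove_sings (\<lambda>z. k * f z) s = k * remove_sings f s"
proof (cases "\<exists>l. f \<midarrow>s\<rightarrow> l")
  case True
  then obtain l where l: "f \<midarrow>s\<rightarrow> l" by auto
  hence "(\<lambda>z. k * f z) \<midarrow>s\<rightarrow> k * l" by (intro tendsto_intros)
  with l show ?thesis by (metis remove_sings_eqI)
next
  case False
  have "\<not> (\<lambda>z. k * f z) \<midarrow>s\<rightarrow> l" for l
  proof
    assume "(\<lambda>z. k * f z) \<midarrow>s\<rightarrow> l"
    hence "(\<lambda>z. inverse k * (k * f z)) \<midarrow>s\<rightarrow> inverse k * l" by (intro tendsto_intros)
    with False assms show False by (auto simp flip: mult.assoc)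
  qed
  with False show ?thesis by (auto simp: remove_sings_def)
qed

text \<open>A negation followed by a translation carries punctured neighbourhoods of s to those of 1
  - s.\<close>

lemma remove_sings_one_minus: "remove_sings (\<lambda>z. f (1 - z)) s = remove_sings f (1 - s)"
proof -
  have "filtermap (\<lambda>z. 1 - z) (at s) = at (1 - s)"
    using filtermap_at_shift[of "-1" "- s"]
    by (simp add: filtermap_filtermap flip: filtermap_at_minus)
  from remove_sings_compose[OF this, of f] show ?thesis by (simp add: o_def)
qed

lemma entire_imp_analytic_on: "f holomorphic_on UNIV \<Longrightarrow> f analytic_on A"
  using analytic_on_open[of UNIV f] analytic_on_subset[of f UNIV A] by auto

section \<open>The extended Lerch zeta function\<close>

text \<open>Writing \<open>rGamma\<close> in place of division by \<open>Gamma\<close> makes these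
  factors visibly entire.\<close>

definition lerch_meromorphic :: "complex \<Rightarrow> real \<Rightarrow> real \<Rightarrow> complex" where
  "lerch_meromorphic z a c = 1 / 2 *
     (of_real pi powr (z / 2) * rGamma (z / 2) * Lambda 0 z a c
      + of_real pi powr ((z + 1) / 2) * rGamma ((z + 1) / 2) * Lambda 1 z a c)"

lemma lerch_zeta_ext_eq: "lerch_zeta_ext s a c = remove_sings (\<lambda>z. lerch_meromorphic z a c) s"
  unfolding lerch_zeta_ext_def lerch_meromorphic_def Lambda_plus_eq Lambda_minus_eq
    rGamma_inverse_Gamma divide_inverse ..

text \<open>The term with \<open>rGamma (z / 2 + 1)\<close> is what remains of the pole of Lambda at
  0: by the recurrence, \<open>rGamma (z / 2) / z\<close> equals half of it. Hence everything here
  is entire.\<close>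

definition lerch_regular :: "complex \<Rightarrow> real \<Rightarrow> real \<Rightarrow> complex" where
  "lerch_regular z a c = 1 / 2 *
     (of_real pi powr (z / 2) * (rGamma (z / 2) * Lambda_entire 0 z a c
        - delta_int c * cis (- (2 * pi * (a * c))) * rGamma (z / 2 + 1))
      + of_real pi powr ((z + 1) / 2) * rGamma ((z + 1) / 2) * Lambda_entire 1 z a c)"

lemma lerch_regular_holomorphic: "(\<lambda>z. lerch_regular z a c) holomorphic_on A"
  unfolding lerch_regular_def by (intro holomorphic_intros Lambda_entire_holomorphic) simp_all

definition lerch_polar :: "complex \<Rightarrow> real \<Rightarrow> complex" where
  "lerch_polar z a = delta_int a * of_real pi powr (z / 2) * rGamma (z / 2)"

lemma lerch_polar_holomorphic: "(\<lambda>z. lerch_polar z a) holomorphic_on A"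
  unfolding lerch_polar_def by (intro holomorphic_intros) simp_all

text \<open>The point 0 is excluded because there division by zero discards the polar term on the
  left, whereas the right side keeps its limit.\<close>

lemma lerch_meromorphic_eq:
  assumes "z \<noteq> 0"
  shows "lerch_meromorphic z a c = lerch_regular z a c + lerch_polar z a / (z - 1)"
proof -
  have "rGamma (z / 2) / z = rGamma (z / 2 + 1) / 2"
    using rGamma_plus1[of "z / 2"] assms by (simp add: field_simps)
  hence r: "rGamma (z / 2) * (d / z) = d * rGamma (z / 2 + 1) / 2" for d
    by (metis mult.commute times_divide_eq_left times_divide_eq_right)
  define X where "X = delta_int c * cis (- (2 * pi * (a * c)))"
  have "rGamma (z / 2) * Lambda 0 z a c
     = rGamma (z / 2) * Lambda_entire 0 z a c + 2 * (delta_int a * rGamma (z / 2)) / (z - 1) 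
       - rGamma (z / 2) * (2 * X / z)"
    by (simp add: Lambda_def X_def algebra_simps)
  also have "\<dots> = rGamma (z / 2) * Lambda_entire 0 z a c - X * rGamma (z / 2 + 1)
       + 2 * (delta_int a * rGamma (z / 2)) / (z - 1)"
    unfolding r by simp
  finally have L: "rGamma (z / 2) * Lambda 0 z a c = \<dots>" .
  define W where "W = of_real pi powr ((z + 1) / 2) * rGamma ((z + 1) / 2) * Lambda_entire 1 z a c"
  have split: "1 / 2 * (p * (U + 2 * V / y) + W) = 1 / 2 * (p * U + W) + p * V / y"
    for p U V y :: complex
    by (simp add: add_divide_distrib distrib_left)
  have "lerch_meromorphic z a c = 1 / 2 * (of_real pi powr (z / 2) * (rGamma (z / 2) * Lambda 0 z a c) + W)"
    by (simp add: lerch_meromorphic_def W_def Lambda_def mult.assoc)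
  also have "\<dots> = lerch_regular z a c + lerch_polar z a / (z - 1)"
    unfolding L split by (simp add: lerch_regular_def lerch_polar_def W_def X_def mult.left_commute mult.assoc)
  finally show ?thesis .
qed

text \<open>This form already has the limiting value at 0, so z = 1 is the only point left where a
  singularity can occur.\<close>

definition lerch_sum :: "complex \<Rightarrow> real \<Rightarrow> real \<Rightarrow> complex" where
  "lerch_sum z a c = lerch_regular z a c + lerch_polar z a / (z - 1)"

lemma eventually_lerch_sum: "eventually (\<lambda>z. lerch_meromorphic z a c = lerch_sum z a c) (at s)"
  using eventually_neq_at_within[of 0 s UNIV]
  by eventually_elim (simp add: lerch_meromorphic_eq lerch_sum_def)

lemma lerch_zeta_ext_eq_sum: "(\<lambda>s. lerch_zeta_ext s a c) = remove_sings (\<lambda>z. lerch_sum z a c)"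
  unfolding lerch_zeta_ext_eq by (intro ext remove_sings_cong eventually_lerch_sum refl)

lemma lerch_sum_analytic_off_one: "(\<lambda>z. lerch_sum z a c) analytic_on - {1}"
proof -
  have "(\<lambda>z. lerch_sum z a c) holomorphic_on - {1}"
    unfolding lerch_sum_def
    by (intro holomorphic_intros lerch_regular_holomorphic lerch_polar_holomorphic) auto
  thus ?thesis using analytic_on_open[of "- {1}"] by auto
qed

lemma lerch_sum_analytic: "a \<notin> \<int> \<Longrightarrow> (\<lambda>z. lerch_sum z a c) analytic_on UNIV"
  using lerch_regular_holomorphic[of a c UNIV]
  by (simp add: lerch_sum_def lerch_polar_def delta_int_def analytic_on_open)

lemma lerch_sum_meromorphic: "(\<lambda>z. lerch_sum z a c) meromorphic_on A"
  unfolding lerch_sum_def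
  by (intro meromorphic_intros analytic_on_imp_meromorphic_on[OF entire_imp_analytic_on]
        lerch_regular_holomorphic lerch_polar_holomorphic)

lemma lerch_sum_simple_pole:
  assumes "a \<in> \<int>"
  shows "simple_pole (\<lambda>z. lerch_sum z a c) 1"
proof (rule simple_poleI[of UNIV _ "\<lambda>z. lerch_regular z a c * (z - 1) + lerch_polar z a"])
  show "(\<lambda>z. lerch_regular z a c * (z - 1) + lerch_polar z a) holomorphic_on UNIV"
    by (intro holomorphic_intros lerch_regular_holomorphic lerch_polar_holomorphic)
  \<comment> \<open>The numerator at z = 1 reduces to the polar part, which is nonzero because
    Gamma(1/2) is the square root of pi.\<close>
  have "rGamma (1 / 2 :: complex) \<noteq> 0"
    by (simp add: rGamma_inverse_Gamma Gamma_one_half_complex)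
  thus "lerch_regular 1 a c * (1 - 1) + lerch_polar 1 a \<noteq> 0"
    using assms by (simp add: lerch_polar_def delta_int_def)
qed (auto simp: lerch_sum_def add_divide_distrib)

text \<open>Write the function as (A + B) / 2 with A from Lambda of index 0 and B from index 1. By
  \<open>Lambda_one_minus\<close>, passing to (1 - a, 1 - c) and removing the phase gives (A - B) /
  2, so the sum isolates A and the difference isolates B.\<close>

lemma lerch_meromorphic_even_odd:
  assumes "k \<le> 1"
  shows "lerch_meromorphic z a c + (-1) ^ k * cis (- (2 * pi * a)) * lerch_meromorphic z (1 - a) (1 - c)
    = of_real pi powr ((z + of_nat k) / 2) * rGamma ((z + of_nat k) / 2) * Lambda k z a c"
proof -
  define A where "A = of_real pi powr (z / 2) * rGamma (z / 2) * Lambda 0 z a c"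
  define B where "B = of_real pi powr ((z + 1) / 2) * rGamma ((z + 1) / 2) * Lambda 1 z a c"
  have "lerch_meromorphic z (1 - a) (1 - c) = cis (2 * pi * a) * (1 / 2 * (A - B))"
    unfolding lerch_meromorphic_def Lambda_one_minus A_def B_def by (simp add: algebra_simps)
  moreover have "cis (- (2 * pi * a)) * (cis (2 * pi * a) * w) = w" for w
    by (simp add: cis_mult flip: mult.assoc)
  ultimately have "cis (- (2 * pi * a)) * lerch_meromorphic z (1 - a) (1 - c) = 1 / 2 * (A - B)"
    by metis
  moreover have "lerch_meromorphic z a c = 1 / 2 * (A + B)"
    by (simp add: lerch_meromorphic_def A_def B_def)
  ultimately have "lerch_meromorphic z a c + (-1) ^ k * cis (- (2 * pi * a)) * lerch_meromorphic z (1 - a) (1 - c)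
     = 1 / 2 * (A + B) + (-1) ^ k * (1 / 2 * (A - B))"
    by (simp only: mult.assoc)
  also have "\<dots> = (if k = 0 then A else B)"
    using assms by (auto simp: le_Suc_eq field_simps)
  also have "\<dots> = of_real pi powr ((z + of_nat k) / 2) * rGamma ((z + of_nat k) / 2) * Lambda k z a c"
    using assms by (auto simp: A_def B_def le_Suc_eq)
  finally show ?thesis .
qed

section \<open>The completed functions\<close>

lemma completed_lerch_eq:
  assumes "k \<le> 1"
  shows "(\<lambda>s. completed_lerch k s a c) = remove_sings (\<lambda>z. Lambda k z a c)"
proof
  fix s
  have exp_cis: "exp (- 2 * of_real pi * \<i> * of_real a) = cis (- (2 * pi * a))"
    by (simp add: cis_conv_exp mult_ac)
  \<comment> \<open>Filling in removable points changes values only at isolated points, so near s,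
    with s itself left out, the explicit formula may be used.\<close>
  have lerch: "eventually (\<lambda>z. lerch_zeta_ext z a c = lerch_meromorphic z a c) (at s)" for a c
  proof -
    have "isolated_singularity_at (\<lambda>z. lerch_sum z a c) s"
      by (rule meromorphic_on_isolated_singularity[OF lerch_sum_meromorphic])
    from eventually_remove_sings_eq_at[OF this] eventually_lerch_sum[of a c s] show ?thesis
      by eventually_elim (use fun_cong[OF lerch_zeta_ext_eq_sum[of a c]] in simp)
  qed
  \<comment> \<open>At z = 2 - k the argument is 1, where \<open>rGamma\<close> is nonzero. Its
    zeros are therefore isolated, and off them the Gamma factors cancel.\<close>
  have "eventually (\<lambda>z. rGamma ((z + of_nat k) / 2) \<noteq> 0 \<and> z \<in> UNIV) (at s)"
  proof (rule non_zero_neighbour_alt[of _ _ _ "2 - of_nat k"])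
    show "(\<lambda>z. rGamma ((z + of_nat k) / 2)) holomorphic_on UNIV"
      by (intro holomorphic_intros) auto
  qed auto
  hence "eventually (\<lambda>z. of_real pi powr (- ((z + of_nat k) / 2)) * Gamma ((z + of_nat k) / 2)
          * (lerch_zeta_ext z a c + (- 1) ^ k * exp (- 2 * of_real pi * \<i> * of_real a)
               * lerch_zeta_ext z (1 - a) (1 - c)) = Lambda k z a c) (at s)"
    using lerch[of a c] lerch[of "1 - a" "1 - c"]
  proof eventually_elim
    case (elim z)
    define p where "p = (z + of_nat k) / 2"
    have "of_real pi powr (- p) * of_real pi powr p = (1::complex)"
      by (simp flip: powr_add)
    moreover have "Gamma p * rGamma p = 1"
      using elim(1) by (simp add: rGamma_inverse_Gamma p_def)
    moreover have "of_real pi powr (- p) * Gamma p * (of_real pi powr p * rGamma p * Lambda k z a c)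
        = (of_real pi powr (- p) * of_real pi powr p) * (Gamma p * rGamma p) * Lambda k z a c"
      by (simp only: mult_ac)
    ultimately show ?case
      unfolding elim exp_cis lerch_meromorphic_even_odd[OF assms] p_def[symmetric] by simp
  qed
  thus "completed_lerch k s a c = remove_sings (\<lambda>z. Lambda k z a c) s"
    unfolding completed_lerch_def by (rule remove_sings_cong) simp
qed

lemma Lambda_analytic:
  assumes "k \<le> 1" "k = 0 \<Longrightarrow> s = 0 \<Longrightarrow> c \<notin> \<int>" "k = 0 \<Longrightarrow> s = 1 \<Longrightarrow> a \<notin> \<int>"
  shows "(\<lambda>z. Lambda k z a c) analytic_on {s}"
proof -
  have E: "(\<lambda>z. Lambda_entire k z a c) analytic_on {s}"
    by (intro entire_imp_analytic_on Lambda_entire_holomorphic assms)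
  show ?thesis
  proof (cases "k = 0")
    case True
    have "(\<lambda>z. 2 * delta_int a / (z - 1)) analytic_on {s}"
      using assms True by (cases "s = 1") (auto simp: delta_int_def intro!: analytic_intros)
    moreover have "(\<lambda>z. 2 * delta_int c * cis (- (2 * pi * (a * c))) / z) analytic_on {s}"
      using assms True by (cases "s = 0") (auto simp: delta_int_def intro!: analytic_intros)
    ultimately have "(\<lambda>z. Lambda_entire k z a c + (2 * delta_int a / (z - 1)
        - 2 * delta_int c * cis (- (2 * pi * (a * c))) / z)) analytic_on {s}"
      by (intro analytic_on_add analytic_on_diff E)
    thus ?thesis using True by (simp add: Lambda_def)
  next
    case False
    thus ?thesis using E by (simp add: Lambda_def)
  qed
qed

lemma Lambda_meromorphic:
  assumes "k \<le> 1"
  shows "(\<lambda>z. Lambda k z a c) meromorphic_on A"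
proof -
  have "(\<lambda>z. Lambda_entire k z a c) meromorphic_on A"
    by (intro analytic_on_imp_meromorphic_on entire_imp_analytic_on Lambda_entire_holomorphic assms)
  thus ?thesis
    unfolding Lambda_def by (cases "k = 0") (auto intro!: meromorphic_intros)
qed

text \<open>Away from 0 the other polar term is holomorphic, so near 1 the numerator over z - 1 is
  holomorphic with value 2 at the pole.\<close>

lemma Lambda_simple_pole_one:
  assumes "a \<in> \<int>"
  shows "simple_pole (\<lambda>z. Lambda 0 z a c) 1"
proof -
  define h where
    "h = (\<lambda>z. Lambda_entire 0 z a c - 2 * delta_int c * cis (- (2 * pi * (a * c))) / z)"
  have h: "h holomorphic_on - {0}"
    unfolding h_def by (intro holomorphic_intros Lambda_entire_holomorphic) auto
  have Lambda: "Lambda 0 z a c = h z + 2 / (z - 1)" for z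
    using assms by (simp add: Lambda_def h_def delta_int_def)
  show ?thesis
    unfolding Lambda
  proof (rule simple_poleI[of "- {0}"])
    show "(\<lambda>z. h z * (z - 1) + 2) holomorphic_on - {0}"
      by (intro holomorphic_intros h)
  qed (auto simp: add_divide_distrib)
qed

lemma Lambda_simple_pole_zero:
  assumes "c \<in> \<int>"
  shows "simple_pole (\<lambda>z. Lambda 0 z a c) 0"
proof -
  define h where "h = (\<lambda>z. Lambda_entire 0 z a c + 2 * delta_int a / (z - 1))"
  define w where "w = 2 * cis (- (2 * pi * (a * c)))"
  have h: "h holomorphic_on - {1}"
    unfolding h_def by (intro holomorphic_intros Lambda_entire_holomorphic) auto
  have Lambda: "Lambda 0 z a c = h z - w / z" for z
    using assms by (simp add: Lambda_def h_def w_def delta_int_def)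
  have "w \<noteq> 0" by (simp add: w_def)
  show ?thesis
    unfolding Lambda
  proof (rule simple_poleI[of "- {1}"])
    show "(\<lambda>z. h z * z - w) holomorphic_on - {1}"
      by (intro holomorphic_intros h)
  qed (use \<open>w \<noteq> 0\<close> in \<open>auto simp: diff_divide_distrib\<close>)
qed

lemma completed_lerch_analytic:
  assumes "k \<le> 1" "k = 0 \<Longrightarrow> s = 0 \<Longrightarrow> c \<notin> \<int>" "k = 0 \<Longrightarrow> s = 1 \<Longrightarrow> a \<notin> \<int>"
  shows "(\<lambda>z. completed_lerch k z a c) analytic_on {s}"
  unfolding completed_lerch_eq[OF assms(1)] by (rule remove_sings_analytic_on[OF Lambda_analytic[OF assms]])

lemma completed_lerch_simple_pole:
  "a \<in> \<int> \<Longrightarrow> simple_pole (\<lambda>z. completed_lerch 0 z a c) 1"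
  "c \<in> \<int> \<Longrightarrow> simple_pole (\<lambda>z. completed_lerch 0 z a c) 0"
  unfolding completed_lerch_eq[OF zero_le_one]
  by (rule simple_pole_remove_sings[OF Lambda_meromorphic[OF zero_le_one]],
      erule Lambda_simple_pole_one Lambda_simple_pole_zero)+

lemma completed_lerch_functional_equation:
  assumes "k \<le> 1"
  shows "completed_lerch k s a c = \<i> ^ k * exp (- 2 * of_real pi * \<i> * of_real a * of_real c)
                * completed_lerch k (1 - s) (1 - c) a"
proof -
  have exp_cis: "exp (- 2 * of_real pi * \<i> * of_real a * of_real c) = cis (- (2 * pi * (a * c)))"
    by (simp add: cis_conv_exp mult_ac)
  have "completed_lerch k s a c = remove_sings (\<lambda>z. Lambda k z a c) s"
    using fun_cong[OF completed_lerch_eq[OF assms]] .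
  \<comment> \<open>The identity for \<open>Lambda\<close> is valid at every z, so it can be
    rewritten inside \<open>remove_sings\<close>; the constant factor and the reflection are then
    moved outside.\<close>
  also have "\<dots> = remove_sings (\<lambda>z. \<i> ^ k * cis (- (2 * pi * (a * c))) * Lambda k (1 - z) (1 - c) a) s"
    by (subst Lambda_functional_equation) simp
  also have "\<dots> = \<i> ^ k * cis (- (2 * pi * (a * c))) * remove_sings (\<lambda>z. Lambda k z (1 - c) a) (1 - s)"
    by (subst remove_sings_cmult) (auto simp: remove_sings_one_minus[of "\<lambda>z. Lambda k z (1 - c) a"])
  also have "remove_sings (\<lambda>z. Lambda k z (1 - c) a) (1 - s) = completed_lerch k (1 - s) (1 - c) a"
    using fun_cong[OF completed_lerch_eq[OF assms]] by simp
  finally show ?thesis unfolding exp_cis .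
qed

lemma lerch_zeta_ext_shift:
  "lerch_zeta_ext s (a + 1) c = lerch_zeta_ext s a c"
  "lerch_zeta_ext s a (c + 1) = exp (- 2 * of_real pi * \<i> * of_real a) * lerch_zeta_ext s a c"
proof -
  show "lerch_zeta_ext s (a + 1) c = lerch_zeta_ext s a c"
    by (simp add: lerch_zeta_ext_eq lerch_meromorphic_def Lambda_shift_left)
  have exp_cis: "exp (- 2 * of_real pi * \<i> * of_real a) = cis (- (2 * pi * a))"
    by (simp add: cis_conv_exp mult_ac)
  have "lerch_meromorphic z a (c + 1) = cis (- (2 * pi * a)) * lerch_meromorphic z a c" for z
    unfolding lerch_meromorphic_def Lambda_shift_right by (simp only: ring_distribs mult_ac)
  thus "lerch_zeta_ext s a (c + 1) = exp (- 2 * of_real pi * \<i> * of_real a) * lerch_zeta_ext s a c"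
    unfolding exp_cis lerch_zeta_ext_eq by (simp add: remove_sings_cmult)
qed

theorem theorem2p2:
  fixes a c :: real
  shows "(\<lambda>s. lerch_zeta_ext s a c) meromorphic_on UNIV
    \<and> (a \<in> \<int> \<longrightarrow> simple_pole (\<lambda>s. lerch_zeta_ext s a c) 1
          \<and> (\<lambda>s. lerch_zeta_ext s a c) holomorphic_on (UNIV - {1}))
    \<and> (a \<notin> \<int> \<longrightarrow> (\<lambda>s. lerch_zeta_ext s a c) holomorphic_on UNIV)
    \<and> (\<forall>s. lerch_zeta_ext s (a + 1) c = lerch_zeta_ext s a c)
    \<and> (\<forall>s. lerch_zeta_ext s a (c + 1)
            = exp (- 2 * of_real pi * \<i> * of_real a) * lerch_zeta_ext s a c)
    \<and> (\<forall>k\<in>{0, 1}.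
          (\<lambda>s. completed_lerch k s a c) meromorphic_on UNIV
        \<and> (\<lambda>s. completed_lerch k s a c) analytic_on (UNIV - {0, 1})
        \<and> (\<forall>p\<in>{0, 1}. (\<lambda>s. completed_lerch k s a c) analytic_on {p}
                      \<or> simple_pole (\<lambda>s. completed_lerch k s a c) p)
        \<and> ((\<exists>p. is_pole (\<lambda>s. completed_lerch k s a c) p)
              \<longleftrightarrow> k = 0 \<and> (a \<in> \<int> \<or> c \<in> \<int>))
        \<and> (\<forall>s. completed_lerch k s a c
              = \<i> ^ k * exp (- 2 * of_real pi * \<i> * of_real a * of_real c)
                * completed_lerch k (1 - s) (1 - c) a))"
proof (intro conjI impI allI ballI)
  show "(\<lambda>s. lerch_zeta_ext s a c) meromorphic_on UNIV"
    unfolding lerch_zeta_ext_eq_sum by (intro remove_sings_meromorphic lerch_sum_meromorphic)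
  show "simple_pole (\<lambda>s. lerch_zeta_ext s a c) 1" if "a \<in> \<int>"
    unfolding lerch_zeta_ext_eq_sum
    by (intro simple_pole_remove_sings lerch_sum_meromorphic lerch_sum_simple_pole that)
  show "(\<lambda>s. lerch_zeta_ext s a c) holomorphic_on (UNIV - {1})" if "a \<in> \<int>"
    unfolding lerch_zeta_ext_eq_sum Compl_eq_Diff_UNIV[symmetric]
    by (intro analytic_imp_holomorphic remove_sings_analytic_on lerch_sum_analytic_off_one)
  show "(\<lambda>s. lerch_zeta_ext s a c) holomorphic_on UNIV" if "a \<notin> \<int>"
    unfolding lerch_zeta_ext_eq_sum
    by (intro analytic_imp_holomorphic remove_sings_analytic_on lerch_sum_analytic that)
next
  fix k :: nat assume "k \<in> {0, 1}"
  hence k: "k \<le> 1" by auto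
  show "(\<lambda>s. completed_lerch k s a c) meromorphic_on UNIV"
    unfolding completed_lerch_eq[OF k] by (intro remove_sings_meromorphic Lambda_meromorphic k)
  show "(\<lambda>s. completed_lerch k s a c) analytic_on (UNIV - {0, 1})"
    by (subst analytic_on_analytic_at) (use completed_lerch_analytic[OF k] in auto)
  show "(\<lambda>s. completed_lerch k s a c) analytic_on {p} \<or> simple_pole (\<lambda>s. completed_lerch k s a c) p"
    if "p \<in> {0, 1}" for p
  \<comment> \<open>Integrality of c governs the pole at 0, and integrality of a the pole at
    1.\<close>
  proof (cases "k = 0 \<and> (if p = 0 then c \<in> \<int> else a \<in> \<int>)")
    case True
    thus ?thesis using that completed_lerch_simple_pole by (auto split: if_splits)
  next
    case False
    thus ?thesis using that by (intro disjI1 completed_lerch_analytic k) auto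
  qed
  show "(\<exists>p. is_pole (\<lambda>s. completed_lerch k s a c) p) \<longleftrightarrow> k = 0 \<and> (a \<in> \<int> \<or> c \<in> \<int>)"
  proof
    \<comment> \<open>A pole rules out analyticity, so one of the conditions of
      \<open>completed_lerch_analytic\<close> must fail at p.\<close>
    assume "\<exists>p. is_pole (\<lambda>s. completed_lerch k s a c) p"
    then obtain p where "\<not> (\<lambda>s. completed_lerch k s a c) analytic_on {p}"
      using analytic_at_imp_no_pole by blast
    thus "k = 0 \<and> (a \<in> \<int> \<or> c \<in> \<int>)"
      using completed_lerch_analytic[OF k, of p c a] by blast
  next
    assume "k = 0 \<and> (a \<in> \<int> \<or> c \<in> \<int>)"
    thus "\<exists>p. is_pole (\<lambda>s. completed_lerch k s a c) p"
      using completed_lerch_simple_pole[of a c] completed_lerch_simple_pole(2)[of c a]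
      by (auto simp: simple_pole_def)
  qed
  show "completed_lerch k s a c = \<i> ^ k * exp (- 2 * of_real pi * \<i> * of_real a * of_real c)
      * completed_lerch k (1 - s) (1 - c) a" for s
    by (rule completed_lerch_functional_equation[OF k])
qed (rule lerch_zeta_ext_shift)+

end
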